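(* Let $R$ be a right coherent ring such that $\mathsf{GFlat}(R)$ is a definable subcategory of $\mathsf{Mod}(R)$ and such that $\underline{\mathsf{GFlatCot}}(R)$ is compactly generated, and let $\mathscr C$ denote the class of compact objects of $\underline{\mathsf{GFlatCot}}(R)$. Then the following are equivalent for a morphism $\underline f\colon M\to N$ in $\underline{\mathsf{GFlatCot}}(R)$: (1) $\underline f$ is a phantom map; (2) $\eta(\underline f)$ is pure relative to $\mathscr C$, that is, $\mathrm{Hom}_R(C,\eta(\underline f))$ is exact for all $C\in\mathscr C$.
   Context: Modules are left modules. A module $M$ is cotorsion if $\mathrm{Ext}^1_R(F,M)=0$ for all flat $F$. $M$ is Gorenstein flat if $M=Z_0(F)$ for an acyclic complex $F$ of flat $R$-modules such that $E\otimes_RF$ is acyclic for every injective right $R$-module $E$; $\mathsf{GFlat}(R)$ is the category of these, and $\mathsf{GFlatCot}(R)$ that of Gorenstein flat cotorsion modules. A subcategory of $\mathsf{Mod}(R)$ is definable if it is closed under products, direct limits and pure submodules. For $R$ right coherent $\mathsf{GFlatCot}(R)$, with short exact sequences of modules, is a Frobenius exact category whose projective-injective objects are the flat cotorsion modules; $\underline{\mathsf{GFlatCot}}(R)$ is its stable triangulated category (same objects), which has all coproducts. Write $\Omega$ for the inverse of the shift. An object $C$ of it is compact if $\mathrm{Hom}(C,-)$ preserves coproducts; the category is compactly generated if it has a set of compact objects detecting zero objects (up to shifts). A morphism $\underline f$ is phantom if $\mathrm{Hom}_{\underline{\mathsf{GFlatCot}}(R)}(C,\underline f)=0$ for all compact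 $C$. For $\underline f\colon M\to N$, complete to a triangle $\Omega N\to X\to M\xrightarrow{\underline f}N$; under the identification $\mathrm{Hom}_{\underline{\mathsf{GFlatCot}}(R)}(M,N)\cong\mathrm{Ext}^1(M,\Omega N)$ (Yoneda extensions in $\mathsf{GFlatCot}(R)$), $\eta(\underline f)$ denotes the corresponding short exact sequence $0\to\Omega N\to X\to M\to0$ of Gorenstein flat cotorsion modules. Objects of $\mathscr C$ are viewed as modules in $\mathsf{GFlatCot}(R)$ in (2). *)

theory Defs
  imports
    "HOL-Algebra.Module"
    "HOL-Algebra.AbelCoset"
    "HOL-Algebra.Exact_Sequence"
    "HOL-Algebra.Free_Abelian_Groups"
begin

unbundle cardinal_syntax

section \<open>The universe of sets\<close>

text \<open>Sets (as opposed to proper classes) are sets with fewer elements than a fixed type 'u whose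
  cardinality is strongly inaccessible, i.e. 'u plays the role of a Grothendieck universe. Modules
  live on small subsets of 'u, so all constructions with sets of modules (products, direct limits,
  quotients, ...) have isomorphic copies there. The predicate \<open>inaccessible\<close> is satisfied, e.g.,
  by the type of all sets of an axiomatisation of ZFC in HOL.\<close>

definition small :: "'u itself \<Rightarrow> 'a set \<Rightarrow> bool" where
  "small _ A \<longleftrightarrow> |A| <o |UNIV :: 'u set|"

definition inaccessible :: "'u itself \<Rightarrow> bool" where
  "inaccessible _ \<longleftrightarrow>
     natLeq <o |UNIV :: 'u set| \<and> regularCard |UNIV :: 'u set| \<and>
     (\<forall>A :: 'u set. |A| <o |UNIV :: 'u set| \<longrightarrow> |Pow A| <o |UNIV :: 'u set| )"


section \<open>Modules over a not necessarily commutative ring\<close>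

text \<open>The locale \<^locale>\<open>module\<close> of the library requires a commutative ring. We use its
  record type; the ring fields \<open>mult\<close> and \<open>one\<close> of a module are irrelevant.\<close>

locale left_module = R?: ring R + M?: abelian_group M
  for R (structure) and M :: "('r, 'm, 'e) module_scheme" (structure) +
  assumes smult_closed [simp, intro]:
      "\<lbrakk>a \<in> carrier R; x \<in> carrier M\<rbrakk> \<Longrightarrow> a \<odot>\<^bsub>M\<^esub> x \<in> carrier M"
    and smult_l_distr:
      "\<lbrakk>a \<in> carrier R; b \<in> carrier R; x \<in> carrier M\<rbrakk> \<Longrightarrow>
        (a \<oplus> b) \<odot>\<^bsub>M\<^esub> x = a \<odot>\<^bsub>M\<^esub> x \<oplus>\<^bsub>M\<^esub> b \<odot>\<^bsub>M\<^esub> x"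
    and smult_r_distr:
      "\<lbrakk>a \<in> carrier R; x \<in> carrier M; y \<in> carrier M\<rbrakk> \<Longrightarrow>
        a \<odot>\<^bsub>M\<^esub> (x \<oplus>\<^bsub>M\<^esub> y) = a \<odot>\<^bsub>M\<^esub> x \<oplus>\<^bsub>M\<^esub> a \<odot>\<^bsub>M\<^esub> y"
    and smult_assoc1:
      "\<lbrakk>a \<in> carrier R; b \<in> carrier R; x \<in> carrier M\<rbrakk> \<Longrightarrow>
        (a \<otimes> b) \<odot>\<^bsub>M\<^esub> x = a \<odot>\<^bsub>M\<^esub> (b \<odot>\<^bsub>M\<^esub> x)"
    and smult_one [simp]:
      "x \<in> carrier M \<Longrightarrow> \<one> \<odot>\<^bsub>M\<^esub> x = x"

text \<open>Right \<open>R\<close>-modules are left modules over \<open>op_ring R\<close>; thus \<open>r \<odot> a\<close> stands for \<open>a r\<close>.\<close>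

definition op_ring :: "'r ring \<Rightarrow> 'r ring" where
  "op_ring R = R\<lparr>monoid.mult := \<lambda>x y. y \<otimes>\<^bsub>R\<^esub> x\<rparr>"

definition Mods :: "'r ring \<Rightarrow> ('r, 'u) module set" where
  "Mods R = {M. left_module R M \<and> small TYPE('u) (carrier M)}"

abbreviation RMods :: "'r ring \<Rightarrow> ('r, 'u) module set" where
  "RMods R \<equiv> Mods (op_ring R)"

text \<open>Homomorphisms are \<open>undefined\<close> outside the carrier, so that equality of homomorphisms
  is equality in HOL; they are composed with \<^const>\<open>compose\<close>.\<close>

definition mod_hom :: "'r ring \<Rightarrow> ('r, 'a) module \<Rightarrow> ('r, 'b) module \<Rightarrow> ('a \<Rightarrow> 'b) set" where
  "mod_hom R M N = {f \<in> carrier M \<rightarrow>\<^sub>E carrier N.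
     (\<forall>x\<in>carrier M. \<forall>y\<in>carrier M. f (x \<oplus>\<^bsub>M\<^esub> y) = f x \<oplus>\<^bsub>N\<^esub> f y) \<and>
     (\<forall>r\<in>carrier R. \<forall>x\<in>carrier M. f (r \<odot>\<^bsub>M\<^esub> x) = r \<odot>\<^bsub>N\<^esub> f x)}"

definition mod_id :: "('r, 'a) module \<Rightarrow> 'a \<Rightarrow> 'a" where
  "mod_id M = (\<lambda>x\<in>carrier M. x)"

definition mod_iso :: "'r ring \<Rightarrow> ('r, 'a) module \<Rightarrow> ('r, 'b) module \<Rightarrow> bool" where
  "mod_iso R M N \<longleftrightarrow> (\<exists>f\<in>mod_hom R M N. bij_betw f (carrier M) (carrier N))"

abbreviation restrict_mod :: "('r, 'a) module \<Rightarrow> 'a set \<Rightarrow> ('r, 'a) module" where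
  "restrict_mod M H \<equiv> M\<lparr>carrier := H\<rparr>"

definition mod_short_exact ::
  "'r ring \<Rightarrow> ('r, 'a) module \<Rightarrow> ('r, 'b) module \<Rightarrow> ('r, 'c) module \<Rightarrow>
    ('a \<Rightarrow> 'b) \<Rightarrow> ('b \<Rightarrow> 'c) \<Rightarrow> bool" where
  "mod_short_exact R A B C i p \<longleftrightarrow>
     i \<in> mod_hom R A B \<and> p \<in> mod_hom R B C \<and>
     inj_on i (carrier A) \<and> i ` carrier A = a_kernel B C p \<and> p ` carrier B = carrier C"

definition prod_mod :: "'i set \<Rightarrow> ('i \<Rightarrow> ('r, 'a) module) \<Rightarrow> ('r, 'i \<Rightarrow> 'a) module" where
  "prod_mod I X =
     \<lparr>carrier = (\<Pi>\<^sub>E i\<in>I. carrier (X i)),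
      monoid.mult = (\<lambda>_ _. undefined), one = undefined,
      ring.zero = (\<lambda>i\<in>I. \<zero>\<^bsub>X i\<^esub>),
      ring.add = (\<lambda>x y. \<lambda>i\<in>I. x i \<oplus>\<^bsub>X i\<^esub> y i),
      smult = (\<lambda>r x. \<lambda>i\<in>I. r \<odot>\<^bsub>X i\<^esub> x i)\<rparr>"


section \<open>Right coherent rings\<close>

definition regular_mod :: "'r ring \<Rightarrow> ('r, 'r) module" where
  "regular_mod S = ring.extend S \<lparr>smult = monoid.mult S\<rparr>"

definition finitely_generated :: "'r ring \<Rightarrow> ('r, 'a) module \<Rightarrow> bool" where
  "finitely_generated S M \<longleftrightarrow>
     (\<exists>A. finite A \<and> A \<subseteq> carrier M \<and> (\<forall>H. submodule H S M \<and> A \<subseteq> H \<longrightarrow> H = carrier M))"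

definition finitely_presented :: "'r ring \<Rightarrow> ('r, 'a) module \<Rightarrow> bool" where
  "finitely_presented S M \<longleftrightarrow>
     (\<exists>n::nat. let L = prod_mod {..<n} (\<lambda>_. regular_mod S) in
        \<exists>p\<in>mod_hom S L M. p ` carrier L = carrier M \<and>
          finitely_generated S (restrict_mod L (a_kernel L M p)))"

definition right_coherent :: "'r ring \<Rightarrow> bool" where
  "right_coherent R \<longleftrightarrow>
     (let S = op_ring R in
      \<forall>I. submodule I S (regular_mod S) \<and> finitely_generated S (restrict_mod (regular_mod S) I) \<longrightarrow>
          finitely_presented S (restrict_mod (regular_mod S) I))"


section \<open>Tensor products\<close>

text \<open>The tensor product of a right module \<open>A\<close> and a left module \<open>F\<close> is the free abelian
  group on \<open>A \<times> F\<close> modulo the usual relations. The library writes these groups multiplicatively.\<close>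

definition tensor_relations ::
  "'r ring \<Rightarrow> ('r, 'a) module \<Rightarrow> ('r, 'b) module \<Rightarrow> ('a \<times> 'b \<Rightarrow>\<^sub>0 int) set" where
  "tensor_relations R A F =
     generate (free_Abelian_group (carrier A \<times> carrier F))
      ({frag_of (a \<oplus>\<^bsub>A\<^esub> a', x) - frag_of (a, x) - frag_of (a', x) | a a' x.
          a \<in> carrier A \<and> a' \<in> carrier A \<and> x \<in> carrier F} \<union>
       {frag_of (a, x \<oplus>\<^bsub>F\<^esub> x') - frag_of (a, x) - frag_of (a, x') | a x x'.
          a \<in> carrier A \<and> x \<in> carrier F \<and> x' \<in> carrier F} \<union>
       {frag_of (r \<odot>\<^bsub>A\<^esub> a, x) - frag_of (a, r \<odot>\<^bsub>F\<^esub> x) | r a x.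
          r \<in> carrier R \<and> a \<in> carrier A \<and> x \<in> carrier F})"

definition tensor ::
  "'r ring \<Rightarrow> ('r, 'a) module \<Rightarrow> ('r, 'b) module \<Rightarrow> ('a \<times> 'b \<Rightarrow>\<^sub>0 int) set monoid" where
  "tensor R A F = free_Abelian_group (carrier A \<times> carrier F) Mod tensor_relations R A F"

text \<open>\<open>tensor_map R B G g f\<close> is the map \<open>g \<otimes> f\<close> into \<open>B \<otimes> G\<close>: it sends the coset of \<open>x\<close> to the
  coset of the image of \<open>x\<close>.\<close>

definition tensor_map ::
  "'r ring \<Rightarrow> ('r, 'c) module \<Rightarrow> ('r, 'd) module \<Rightarrow> ('a \<Rightarrow> 'c) \<Rightarrow> ('b \<Rightarrow> 'd) \<Rightarrow>
    ('a \<times> 'b \<Rightarrow>\<^sub>0 int) set \<Rightarrow> ('c \<times> 'd \<Rightarrow>\<^sub>0 int) set" where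
  "tensor_map R B G g f c =
     tensor_relations R B G <#>\<^bsub>free_Abelian_group (carrier B \<times> carrier G)\<^esub>
       (frag_extend (\<lambda>(a, x). frag_of (g a, f x)) ` c)"


section \<open>Flat, cotorsion and Gorenstein flat modules\<close>

text \<open>Note that \<^const>\<open>short_exact_sequence\<close> lists its groups and maps from right to left.\<close>

definition flat :: "'r ring \<Rightarrow> ('r, 'u) module \<Rightarrow> bool" where
  "flat R F \<longleftrightarrow> F \<in> Mods R \<and>
     (\<forall>A\<in>RMods R. \<forall>B\<in>RMods R. \<forall>C\<in>RMods R.
       \<forall>(i :: 'u \<Rightarrow> 'u) (p :: 'u \<Rightarrow> 'u). mod_short_exact (op_ring R) A B C i p \<longrightarrow>
         short_exact_sequence (tensor R C F) (tensor R B F) (tensor R A F)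
           (tensor_map R C F p (mod_id F)) (tensor_map R B F i (mod_id F)))"

definition injective :: "'r ring \<Rightarrow> ('r, 'u) module \<Rightarrow> bool" where
  "injective S E \<longleftrightarrow> E \<in> Mods S \<and>
     (\<forall>A\<in>Mods S. \<forall>B\<in>Mods S. \<forall>(i :: 'u \<Rightarrow> 'u)\<in>mod_hom S A B. inj_on i (carrier A) \<longrightarrow>
        (\<forall>f\<in>mod_hom S A E. \<exists>g\<in>mod_hom S B E. compose (carrier A) g i = f))"

text \<open>Yoneda extensions \<open>0 \<rightarrow> A \<rightarrow> B \<rightarrow> C \<rightarrow> 0\<close> with middle term in a class \<open>\<X>\<close> of modules, represented
  as triples \<open>(B, i, p)\<close>.\<close>

type_synonym ('r, 'u) extension = "('r, 'u) module \<times> ('u \<Rightarrow> 'u) \<times> ('u \<Rightarrow> 'u)"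

definition extensions ::
  "'r ring \<Rightarrow> ('r, 'u) module set \<Rightarrow> ('r, 'u) module \<Rightarrow> ('r, 'u) module \<Rightarrow>
    ('r, 'u) extension set" where
  "extensions R \<X> C A = {(B, i, p). B \<in> \<X> \<and> mod_short_exact R A B C i p}"

definition yoneda_rel ::
  "'r ring \<Rightarrow> ('r, 'u) module set \<Rightarrow> ('r, 'u) module \<Rightarrow> ('r, 'u) module \<Rightarrow>
    (('r, 'u) extension \<times> ('r, 'u) extension) set" where
  "yoneda_rel R \<X> C A =
     {((B, i, p), (B', i', p')) | B i p B' i' p'.
        (B, i, p) \<in> extensions R \<X> C A \<and> (B', i', p') \<in> extensions R \<X> C A \<and>
        (\<exists>h\<in>mod_hom R B B'. compose (carrier A) h i = i' \<and> compose (carrier B) p' h = p)}"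

definition Ext1 ::
  "'r ring \<Rightarrow> ('r, 'u) module \<Rightarrow> ('r, 'u) module \<Rightarrow> ('r, 'u) extension set set" where
  "Ext1 R C A = extensions R (Mods R) C A // yoneda_rel R (Mods R) C A"

text \<open>The zero element of \<open>Ext1 R C A\<close> is the class consisting of the split extensions.\<close>

definition Ext1_zero ::
  "'r ring \<Rightarrow> ('r, 'u) module \<Rightarrow> ('r, 'u) module \<Rightarrow> ('r, 'u) extension set" where
  "Ext1_zero R C A = {(B, i, p) \<in> extensions R (Mods R) C A.
     \<exists>s\<in>mod_hom R C B. compose (carrier C) p s = mod_id C}"

definition cotorsion :: "'r ring \<Rightarrow> ('r, 'u) module \<Rightarrow> bool" where
  "cotorsion R M \<longleftrightarrow> M \<in> Mods R \<and> (\<forall>F. flat R F \<longrightarrow> Ext1 R F M = {Ext1_zero R F M})"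

definition GFlat :: "'r ring \<Rightarrow> ('r, 'u) module set" where
  "GFlat R = {M \<in> Mods R. \<exists>(F :: int \<Rightarrow> ('r, 'u) module) d.
     (\<forall>n. flat R (F n) \<and> d n \<in> mod_hom R (F n) (F (n - 1))) \<and>
     (\<forall>n. d (n + 1) ` carrier (F (n + 1)) = a_kernel (F n) (F (n - 1)) (d n)) \<and>
     (\<forall>E :: ('r, 'u) module. injective (op_ring R) E \<longrightarrow>
        (\<forall>n. tensor_map R E (F n) (mod_id E) (d (n + 1)) ` carrier (tensor R E (F (n + 1)))
             = kernel (tensor R E (F n)) (tensor R E (F (n - 1)))
                 (tensor_map R E (F (n - 1)) (mod_id E) (d n)))) \<and>
     mod_iso R M (restrict_mod (F 0) (a_kernel (F 0) (F (- 1)) (d 0)))}"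

definition GFlatCot :: "'r ring \<Rightarrow> ('r, 'u) module set" where
  "GFlatCot R = {M \<in> GFlat R. cotorsion R M}"

definition FlatCot :: "'r ring \<Rightarrow> ('r, 'u) module set" where
  "FlatCot R = {M. flat R M \<and> cotorsion R M}"


section \<open>Definable subcategories\<close>

definition closed_under_products :: "'r ring \<Rightarrow> ('r, 'u) module set \<Rightarrow> bool" where
  "closed_under_products R \<D> \<longleftrightarrow>
     (\<forall>(I :: 'u set) X. \<forall>P\<in>Mods R. small TYPE('u) I \<and> (\<forall>i\<in>I. X i \<in> \<D>) \<and>
        mod_iso R P (prod_mod I X) \<longrightarrow> P \<in> \<D>)"

definition direct_system ::
  "'r ring \<Rightarrow> 'i set \<Rightarrow> ('i \<Rightarrow> 'i \<Rightarrow> bool) \<Rightarrow> ('i \<Rightarrow> ('r, 'u) module) \<Rightarrow>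
    ('i \<Rightarrow> 'i \<Rightarrow> 'u \<Rightarrow> 'u) \<Rightarrow> bool" where
  "direct_system R I rl X \<phi> \<longleftrightarrow>
     I \<noteq> {} \<and> (\<forall>i\<in>I. rl i i) \<and>
     (\<forall>i\<in>I. \<forall>j\<in>I. \<forall>k\<in>I. rl i j \<and> rl j k \<longrightarrow> rl i k) \<and>
     (\<forall>i\<in>I. \<forall>j\<in>I. \<exists>k\<in>I. rl i k \<and> rl j k) \<and>
     (\<forall>i\<in>I. X i \<in> Mods R \<and> \<phi> i i = mod_id (X i)) \<and>
     (\<forall>i\<in>I. \<forall>j\<in>I. rl i j \<longrightarrow> \<phi> i j \<in> mod_hom R (X i) (X j)) \<and>
     (\<forall>i\<in>I. \<forall>j\<in>I. \<forall>k\<in>I. rl i j \<and> rl j k \<longrightarrow>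
        compose (carrier (X i)) (\<phi> j k) (\<phi> i j) = \<phi> i k)"

definition direct_cocone ::
  "'r ring \<Rightarrow> 'i set \<Rightarrow> ('i \<Rightarrow> 'i \<Rightarrow> bool) \<Rightarrow> ('i \<Rightarrow> ('r, 'u) module) \<Rightarrow>
    ('i \<Rightarrow> 'i \<Rightarrow> 'u \<Rightarrow> 'u) \<Rightarrow> ('r, 'u) module \<Rightarrow> ('i \<Rightarrow> 'u \<Rightarrow> 'u) \<Rightarrow> bool" where
  "direct_cocone R I rl X \<phi> L \<psi> \<longleftrightarrow>
     L \<in> Mods R \<and> (\<forall>i\<in>I. \<psi> i \<in> mod_hom R (X i) L) \<and>
     (\<forall>i\<in>I. \<forall>j\<in>I. rl i j \<longrightarrow> compose (carrier (X i)) (\<psi> j) (\<phi> i j) = \<psi> i)"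

definition is_direct_limit ::
  "'r ring \<Rightarrow> 'i set \<Rightarrow> ('i \<Rightarrow> 'i \<Rightarrow> bool) \<Rightarrow> ('i \<Rightarrow> ('r, 'u) module) \<Rightarrow>
    ('i \<Rightarrow> 'i \<Rightarrow> 'u \<Rightarrow> 'u) \<Rightarrow> ('r, 'u) module \<Rightarrow> ('i \<Rightarrow> 'u \<Rightarrow> 'u) \<Rightarrow> bool" where
  "is_direct_limit R I rl X \<phi> L \<psi> \<longleftrightarrow>
     direct_cocone R I rl X \<phi> L \<psi> \<and>
     (\<forall>T \<tau>. direct_cocone R I rl X \<phi> T \<tau> \<longrightarrow>
        (\<exists>!h. h \<in> mod_hom R L T \<and> (\<forall>i\<in>I. compose (carrier (X i)) h (\<psi> i) = \<tau> i)))"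

definition closed_under_direct_limits :: "'r ring \<Rightarrow> ('r, 'u) module set \<Rightarrow> bool" where
  "closed_under_direct_limits R \<D> \<longleftrightarrow>
     (\<forall>(I :: 'u set) rl X \<phi> L \<psi>. small TYPE('u) I \<and> direct_system R I rl X \<phi> \<and>
        (\<forall>i\<in>I. X i \<in> \<D>) \<and> is_direct_limit R I rl X \<phi> L \<psi> \<longrightarrow> L \<in> \<D>)"

definition pure_submodule :: "'r ring \<Rightarrow> 'u set \<Rightarrow> ('r, 'u) module \<Rightarrow> bool" where
  "pure_submodule R H M \<longleftrightarrow> submodule H R M \<and>
     (\<forall>A :: ('r, 'u) module. A \<in> RMods R \<longrightarrow>
        inj_on (tensor_map R A M (mod_id A) (mod_id (restrict_mod M H)))
               (carrier (tensor R A (restrict_mod M H))))"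

definition definable :: "'r ring \<Rightarrow> ('r, 'u) module set \<Rightarrow> bool" where
  "definable R \<D> \<longleftrightarrow> \<D> \<subseteq> Mods R \<and>
     closed_under_products R \<D> \<and> closed_under_direct_limits R \<D> \<and>
     (\<forall>M\<in>\<D>. \<forall>H. pure_submodule R H M \<longrightarrow> restrict_mod M H \<in> \<D>)"


section \<open>The stable category of Gorenstein flat cotorsion modules\<close>

text \<open>Morphism groups are written multiplicatively, so that \<open>\<one>\<close> is the zero morphism.\<close>

definition hom_group :: "'r ring \<Rightarrow> ('r, 'u) module \<Rightarrow> ('r, 'u) module \<Rightarrow> ('u \<Rightarrow> 'u) monoid" where
  "hom_group R M N =
     \<lparr>carrier = mod_hom R M N,
      monoid.mult = (\<lambda>f g. \<lambda>x\<in>carrier M. f x \<oplus>\<^bsub>N\<^esub> g x),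
      one = (\<lambda>x\<in>carrier M. \<zero>\<^bsub>N\<^esub>)\<rparr>"

definition flatcot_maps :: "'r ring \<Rightarrow> ('r, 'u) module \<Rightarrow> ('r, 'u) module \<Rightarrow> ('u \<Rightarrow> 'u) set" where
  "flatcot_maps R M N =
     {compose (carrier M) b a | (Q :: ('r, 'u) module) a b. Q \<in> FlatCot R \<and> a \<in> mod_hom R M Q \<and> b \<in> mod_hom R Q N}"

text \<open>A stable morphism is thus a coset of homomorphisms; objects are those of \<^const>\<open>GFlatCot\<close>.\<close>

definition stable_hom ::
  "'r ring \<Rightarrow> ('r, 'u) module \<Rightarrow> ('r, 'u) module \<Rightarrow> ('u \<Rightarrow> 'u) set monoid" where
  "stable_hom R M N = hom_group R M N Mod flatcot_maps R M N"

definition stable_comp ::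
  "'r ring \<Rightarrow> ('r, 'u) module \<Rightarrow> ('r, 'u) module \<Rightarrow>
    ('u \<Rightarrow> 'u) set \<Rightarrow> ('u \<Rightarrow> 'u) set \<Rightarrow> ('u \<Rightarrow> 'u) set" where
  "stable_comp R L N \<g> \<f> =
     flatcot_maps R L N <#>\<^bsub>hom_group R L N\<^esub> {compose (carrier L) g f | g f. g \<in> \<g> \<and> f \<in> \<f>}"

definition stable_zero :: "'r ring \<Rightarrow> ('r, 'u) module \<Rightarrow> bool" where
  "stable_zero R X \<longleftrightarrow> X \<in> GFlatCot R \<and>
     (\<forall>Y\<in>GFlatCot R. trivial_group (stable_hom R X Y) \<and> trivial_group (stable_hom R Y X))"

definition is_stable_coproduct ::
  "'r ring \<Rightarrow> 'i set \<Rightarrow> ('i \<Rightarrow> ('r, 'u) module) \<Rightarrow> ('r, 'u) module \<Rightarrow>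
    ('i \<Rightarrow> ('u \<Rightarrow> 'u) set) \<Rightarrow> bool" where
  "is_stable_coproduct R I X S \<iota> \<longleftrightarrow>
     S \<in> GFlatCot R \<and>
     (\<forall>i\<in>I. X i \<in> GFlatCot R \<and> \<iota> i \<in> carrier (stable_hom R (X i) S)) \<and>
     (\<forall>T\<in>GFlatCot R. \<forall>\<tau>. (\<forall>i\<in>I. \<tau> i \<in> carrier (stable_hom R (X i) T)) \<longrightarrow>
        (\<exists>!\<h>. \<h> \<in> carrier (stable_hom R S T) \<and>
              (\<forall>i\<in>I. stable_comp R (X i) T \<h> (\<iota> i) = \<tau> i)))"

text \<open>\<open>C\<close> is compact iff the canonical map \<open>\<Oplus>\<^sub>i Hom(C, X\<^sub>i) \<rightarrow> Hom(C, \<Coprod>\<^sub>i X\<^sub>i)\<close> is always bijective.\<close>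

definition compact_object :: "'r ring \<Rightarrow> ('r, 'u) module \<Rightarrow> bool" where
  "compact_object R C \<longleftrightarrow> C \<in> GFlatCot R \<and>
     (\<forall>(I :: 'u set) X S \<iota>. small TYPE('u) I \<and> is_stable_coproduct R I X S \<iota> \<longrightarrow>
        bij_betw (\<lambda>\<h>. gfinprod (stable_hom R C S) (\<lambda>i. stable_comp R C S (\<iota> i) (\<h> i)) I)
          (carrier (sum_group I (\<lambda>i. stable_hom R C (X i))))
          (carrier (stable_hom R C S)))"

text \<open>\<open>0 \<rightarrow> \<Omega>N \<rightarrow> P \<rightarrow> N \<rightarrow> 0\<close> in \<^const>\<open>GFlatCot\<close> with \<open>P\<close> projective-injective; \<open>\<Omega>N\<close> is the
  desuspension of \<open>N\<close>, and \<open>N\<close> the suspension (shift) of \<open>\<Omega>N\<close>.\<close>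

definition syzygy ::
  "'r ring \<Rightarrow> ('r, 'u) module \<Rightarrow> ('r, 'u) module \<Rightarrow> ('r, 'u) module \<Rightarrow>
    ('u \<Rightarrow> 'u) \<Rightarrow> ('u \<Rightarrow> 'u) \<Rightarrow> bool" where
  "syzygy R N \<Omega>N P j q \<longleftrightarrow>
     N \<in> GFlatCot R \<and> \<Omega>N \<in> GFlatCot R \<and> P \<in> FlatCot R \<and> mod_short_exact R \<Omega>N P N j q"

inductive iterated_shift :: "'r ring \<Rightarrow> ('r, 'u) module \<Rightarrow> ('r, 'u) module \<Rightarrow> bool"
  for R C where
    zero: "iterated_shift R C C"
  | up: "\<lbrakk>iterated_shift R C D; syzygy R E D P j q\<rbrakk> \<Longrightarrow> iterated_shift R C E"
  | down: "\<lbrakk>iterated_shift R C D; syzygy R D K P j q\<rbrakk> \<Longrightarrow> iterated_shift R C K"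

definition compactly_generated :: "'u itself \<Rightarrow> 'r ring \<Rightarrow> bool" where
  "compactly_generated _ R \<longleftrightarrow>
     (\<exists>\<G> :: ('r, 'u) module set. small TYPE('u) \<G> \<and> (\<forall>C\<in>\<G>. compact_object R C) \<and>
        (\<forall>X\<in>GFlatCot R.
           (\<forall>C\<in>\<G>. \<forall>D. iterated_shift R C D \<longrightarrow> trivial_group (stable_hom R D X)) \<longrightarrow>
           stable_zero R X))"


section \<open>Phantom maps and the sequence of a stable morphism\<close>

definition phantom ::
  "'r ring \<Rightarrow> ('r, 'u) module \<Rightarrow> ('r, 'u) module \<Rightarrow> ('u \<Rightarrow> 'u) set \<Rightarrow> bool" where
  "phantom R M N \<f> \<longleftrightarrow>
     (\<forall>C. compact_object R C \<longrightarrow>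
        (\<forall>\<h>\<in>carrier (stable_hom R C M). stable_comp R C N \<f> \<h> = \<one>\<^bsub>stable_hom R C N\<^esub>))"

text \<open>For \<open>syzygy R N \<Omega>N P j q\<close>, the isomorphism from \<open>Hom(M, N)\<close> in the stable category to
  \<open>Ext\<^sup>1(M, \<Omega>N)\<close> sends the class of \<open>f : M \<rightarrow> N\<close> to the Yoneda class of the pullback of
  \<open>0 \<rightarrow> \<Omega>N \<rightarrow> P \<rightarrow> N \<rightarrow> 0\<close> along \<open>f\<close>. Its members are the sequences fitting in a commutative
  diagram with exact rows

    \<open>0 \<rightarrow> \<Omega>N \<rightarrow> X \<rightarrow> M \<rightarrow> 0\<close>
    \<open>     \<parallel>     \<down>     \<down>\<close>
    \<open>0 \<rightarrow> \<Omega>N \<rightarrow> P \<rightarrow> N \<rightarrow> 0\<close>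

  whose right vertical map represents the given stable morphism; by the construction of the
  triangulation of the stable category of a Frobenius category this means that \<open>\<Omega>N \<rightarrow> X \<rightarrow> M\<close>
  is completed by that morphism to a standard triangle \<open>\<Omega>N \<rightarrow> X \<rightarrow> M \<rightarrow> N\<close>.\<close>

definition eta ::
  "'r ring \<Rightarrow> ('r, 'u) module \<Rightarrow> ('r, 'u) module \<Rightarrow> ('r, 'u) module \<Rightarrow>
    ('u \<Rightarrow> 'u) \<Rightarrow> ('u \<Rightarrow> 'u) \<Rightarrow> ('u \<Rightarrow> 'u) set \<Rightarrow> ('r, 'u) extension set" where
  "eta R M \<Omega>N P j q \<f> =
     {(X, i, p) \<in> extensions R (GFlatCot R) M \<Omega>N.
        \<exists>f\<in>\<f>. \<exists>g\<in>mod_hom R X P.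
          compose (carrier \<Omega>N) g i = j \<and> compose (carrier X) q g = compose (carrier X) f p}"

definition pure_relative ::
  "'r ring \<Rightarrow> ('r, 'u) module set \<Rightarrow> ('r, 'u) module \<Rightarrow> ('r, 'u) module \<Rightarrow> ('r, 'u) module \<Rightarrow>
    ('u \<Rightarrow> 'u) \<Rightarrow> ('u \<Rightarrow> 'u) \<Rightarrow> bool" where
  "pure_relative R \<C> A B D i p \<longleftrightarrow>
     (\<forall>C\<in>\<C>. short_exact_sequence (hom_group R C D) (hom_group R C B) (hom_group R C A)
        (compose (carrier C) p) (compose (carrier C) i))"

end

theory Submission
  imports Defs
begin

text \<open>Since \<open>\<Omega>N\<close> is cotorsion, every map from a flat module to \<open>N\<close> lifts along \<open>q : P \<rightarrow> N\<close>; so a map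
  \<open>C \<rightarrow> N\<close> is stably zero iff it factors through \<open>q\<close>. As \<open>X\<close> is the pullback of \<open>q\<close> along a
  representative \<open>f\<close> of \<open>\<f>\<close>, a map \<open>h : C \<rightarrow> M\<close> lifts to \<open>X\<close> iff \<open>f \<circ> h\<close> factors through \<open>q\<close>,
  i.e. iff the stable class of \<open>f \<circ> h\<close> vanishes.\<close>

section \<open>Homomorphisms of modules\<close>

lemma (in left_module) smult_r_zero:
  assumes "a \<in> carrier R"
  shows "a \<odot>\<^bsub>M\<^esub> \<zero>\<^bsub>M\<^esub> = \<zero>\<^bsub>M\<^esub>"
proof -
  have "a \<odot>\<^bsub>M\<^esub> \<zero>\<^bsub>M\<^esub> \<oplus>\<^bsub>M\<^esub> a \<odot>\<^bsub>M\<^esub> \<zero>\<^bsub>M\<^esub> = a \<odot>\<^bsub>M\<^esub> \<zero>\<^bsub>M\<^esub>"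
    using smult_r_distr[OF assms, of "\<zero>\<^bsub>M\<^esub>" "\<zero>\<^bsub>M\<^esub>"] by simp
  then show ?thesis
    by (metis M.add.l_cancel_one M.zero_closed assms smult_closed)
qed

lemma (in left_module) smult_r_minus:
  assumes "a \<in> carrier R" "x \<in> carrier M"
  shows "a \<odot>\<^bsub>M\<^esub> (\<ominus>\<^bsub>M\<^esub> x) = \<ominus>\<^bsub>M\<^esub> (a \<odot>\<^bsub>M\<^esub> x)"
proof -
  have "a \<odot>\<^bsub>M\<^esub> (\<ominus>\<^bsub>M\<^esub> x) \<oplus>\<^bsub>M\<^esub> a \<odot>\<^bsub>M\<^esub> x = \<zero>\<^bsub>M\<^esub>"
    using smult_r_distr[OF assms(1), of "\<ominus>\<^bsub>M\<^esub> x" x] assms by (simp add: M.l_neg smult_r_zero)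
  then show ?thesis
    using assms by (metis M.a_inv_closed M.minus_equality smult_closed)
qed

lemma left_moduleI:
  assumes "ring R" "abelian_group M"
    and "\<And>a x. \<lbrakk>a \<in> carrier R; x \<in> carrier M\<rbrakk> \<Longrightarrow> a \<odot>\<^bsub>M\<^esub> x \<in> carrier M"
    and "\<And>a b x. \<lbrakk>a \<in> carrier R; b \<in> carrier R; x \<in> carrier M\<rbrakk> \<Longrightarrow>
      (a \<oplus>\<^bsub>R\<^esub> b) \<odot>\<^bsub>M\<^esub> x = a \<odot>\<^bsub>M\<^esub> x \<oplus>\<^bsub>M\<^esub> b \<odot>\<^bsub>M\<^esub> x"
    and "\<And>a x y. \<lbrakk>a \<in> carrier R; x \<in> carrier M; y \<in> carrier M\<rbrakk> \<Longrightarrow>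
      a \<odot>\<^bsub>M\<^esub> (x \<oplus>\<^bsub>M\<^esub> y) = a \<odot>\<^bsub>M\<^esub> x \<oplus>\<^bsub>M\<^esub> a \<odot>\<^bsub>M\<^esub> y"
    and "\<And>a b x. \<lbrakk>a \<in> carrier R; b \<in> carrier R; x \<in> carrier M\<rbrakk> \<Longrightarrow>
      (a \<otimes>\<^bsub>R\<^esub> b) \<odot>\<^bsub>M\<^esub> x = a \<odot>\<^bsub>M\<^esub> (b \<odot>\<^bsub>M\<^esub> x)"
    and "\<And>x. x \<in> carrier M \<Longrightarrow> \<one>\<^bsub>R\<^esub> \<odot>\<^bsub>M\<^esub> x = x"
  shows "left_module R M"
  using assms by (auto simp: left_module_def left_module_axioms_def)

lemma mod_homI:
  assumes "f \<in> carrier M \<rightarrow>\<^sub>E carrier N"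
    and "\<And>x y. \<lbrakk>x \<in> carrier M; y \<in> carrier M\<rbrakk> \<Longrightarrow> f (x \<oplus>\<^bsub>M\<^esub> y) = f x \<oplus>\<^bsub>N\<^esub> f y"
    and "\<And>r x. \<lbrakk>r \<in> carrier R; x \<in> carrier M\<rbrakk> \<Longrightarrow> f (r \<odot>\<^bsub>M\<^esub> x) = r \<odot>\<^bsub>N\<^esub> f x"
  shows "f \<in> mod_hom R M N"
  using assms by (simp add: mod_hom_def)

lemma mod_hom_closed: "\<lbrakk>f \<in> mod_hom R M N; x \<in> carrier M\<rbrakk> \<Longrightarrow> f x \<in> carrier N"
  by (auto simp: mod_hom_def)

lemma mod_hom_funcset: "f \<in> mod_hom R M N \<Longrightarrow> f \<in> carrier M \<rightarrow> carrier N"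
  by (auto simp: mod_hom_def)

lemma mod_hom_add:
  "\<lbrakk>f \<in> mod_hom R M N; x \<in> carrier M; y \<in> carrier M\<rbrakk> \<Longrightarrow> f (x \<oplus>\<^bsub>M\<^esub> y) = f x \<oplus>\<^bsub>N\<^esub> f y"
  by (simp add: mod_hom_def)

lemma mod_hom_smult:
  "\<lbrakk>f \<in> mod_hom R M N; r \<in> carrier R; x \<in> carrier M\<rbrakk> \<Longrightarrow> f (r \<odot>\<^bsub>M\<^esub> x) = r \<odot>\<^bsub>N\<^esub> f x"
  by (simp add: mod_hom_def)

lemma mod_hom_zero:
  assumes "left_module R M" "left_module R N" "f \<in> mod_hom R M N"
  shows "f \<zero>\<^bsub>M\<^esub> = \<zero>\<^bsub>N\<^esub>"
proof -
  interpret M: left_module R M by fact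
  interpret N: left_module R N by fact
  have "f \<zero>\<^bsub>M\<^esub> \<oplus>\<^bsub>N\<^esub> f \<zero>\<^bsub>M\<^esub> = f \<zero>\<^bsub>M\<^esub>"
    using mod_hom_add[OF assms(3), of "\<zero>\<^bsub>M\<^esub>" "\<zero>\<^bsub>M\<^esub>"] by simp
  then show ?thesis
    using mod_hom_closed[OF assms(3), of "\<zero>\<^bsub>M\<^esub>"] by (metis N.M.add.l_cancel_one M.M.zero_closed)
qed

lemma mod_hom_minus:
  assumes "left_module R M" "left_module R N" "f \<in> mod_hom R M N" "x \<in> carrier M"
  shows "f (\<ominus>\<^bsub>M\<^esub> x) = \<ominus>\<^bsub>N\<^esub> f x"
proof -
  interpret M: left_module R M by fact
  interpret N: left_module R N by fact
  have "f (\<ominus>\<^bsub>M\<^esub> x) \<oplus>\<^bsub>N\<^esub> f x = \<zero>\<^bsub>N\<^esub>"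
    using mod_hom_add[OF assms(3), of "\<ominus>\<^bsub>M\<^esub> x" x] mod_hom_zero[OF assms(1-3)] assms(4)
    by (simp add: M.M.l_neg)
  then show ?thesis
    using assms(4) mod_hom_closed[OF assms(3)] by (metis M.M.a_inv_closed N.M.minus_equality)
qed

lemma mod_hom_eqI:
  assumes "f \<in> mod_hom R M N" "g \<in> mod_hom R M N" "\<And>x. x \<in> carrier M \<Longrightarrow> f x = g x"
  shows "f = g"
  using assms by (intro extensionalityI[of _ "carrier M"]) (auto simp: mod_hom_def PiE_def)

lemma mod_id_hom:
  assumes "left_module R M"
  shows "mod_id M \<in> mod_hom R M M"
proof -
  interpret left_module R M by fact
  show ?thesis by (auto simp: mod_hom_def mod_id_def)
qed

lemma compose_mod_hom:
  assumes "left_module R A" "f \<in> mod_hom R A B" "g \<in> mod_hom R B C"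
  shows "compose (carrier A) g f \<in> mod_hom R A C"
proof -
  interpret A: left_module R A by fact
  show ?thesis
    using assms(2,3)
    by (intro mod_homI) (auto simp: compose_def mod_hom_closed mod_hom_add mod_hom_smult)
qed

lemma mod_kernel_iff: "x \<in> a_kernel M N f \<longleftrightarrow> x \<in> carrier M \<and> f x = \<zero>\<^bsub>N\<^esub>"
  by (simp add: a_kernel_def')

section \<open>Groups of homomorphisms\<close>

lemma comm_group_hom_group:
  assumes "left_module R M" "left_module R N"
  shows "comm_group (hom_group R M N)"
proof (rule comm_groupI)
  interpret M: left_module R M by fact
  interpret N: left_module R N by fact
  show "\<one>\<^bsub>hom_group R M N\<^esub> \<in> carrier (hom_group R M N)"
    by (auto simp: hom_group_def mod_hom_def N.smult_r_zero)
  fix f g h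
  assume f: "f \<in> carrier (hom_group R M N)" and g: "g \<in> carrier (hom_group R M N)"
    and h: "h \<in> carrier (hom_group R M N)"
  show "f \<otimes>\<^bsub>hom_group R M N\<^esub> g \<in> carrier (hom_group R M N)"
    using f g by (auto simp: hom_group_def mod_hom_closed mod_hom_add mod_hom_smult
        N.smult_r_distr N.M.add.m_ac intro!: mod_homI)
  show "f \<otimes>\<^bsub>hom_group R M N\<^esub> g \<otimes>\<^bsub>hom_group R M N\<^esub> h =
      f \<otimes>\<^bsub>hom_group R M N\<^esub> (g \<otimes>\<^bsub>hom_group R M N\<^esub> h)"
    using f g h by (auto simp: hom_group_def mod_hom_closed N.M.add.m_ac intro!: restrict_ext)
  show "f \<otimes>\<^bsub>hom_group R M N\<^esub> g = g \<otimes>\<^bsub>hom_group R M N\<^esub> f"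
    using f g by (auto simp: hom_group_def mod_hom_closed N.M.add.m_ac intro!: restrict_ext)
  show "\<one>\<^bsub>hom_group R M N\<^esub> \<otimes>\<^bsub>hom_group R M N\<^esub> f = f"
    using f by (auto simp: hom_group_def mod_hom_def PiE_def extensional_def fun_eq_iff Pi_iff)
  have "(\<lambda>x\<in>carrier M. \<ominus>\<^bsub>N\<^esub> f x) \<in> carrier (hom_group R M N)"
    using f by (auto simp: hom_group_def mod_hom_closed mod_hom_add mod_hom_smult
        N.smult_r_minus N.M.minus_add intro!: mod_homI)
  moreover have "(\<lambda>x\<in>carrier M. \<ominus>\<^bsub>N\<^esub> f x) \<otimes>\<^bsub>hom_group R M N\<^esub> f = \<one>\<^bsub>hom_group R M N\<^esub>"
    using f by (auto simp: hom_group_def mod_hom_closed N.M.l_neg intro!: restrict_ext)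
  ultimately show "\<exists>g\<in>carrier (hom_group R M N).
      g \<otimes>\<^bsub>hom_group R M N\<^esub> f = \<one>\<^bsub>hom_group R M N\<^esub>" by blast
qed

text \<open>Additivity of \<open>g\<close> carries over pointwise. The homomorphism serves twice:
  for the exactness of \<open>Hom(C,-)\<close>, and to recognise sets of composites as
  subgroups.\<close>

lemma group_hom_compose:
  assumes "left_module R C" "left_module R A" "left_module R B" "g \<in> mod_hom R A B"
  shows "group_hom (hom_group R C A) (hom_group R C B) (compose (carrier C) g)"
proof -
  have "compose (carrier C) g \<in> hom (hom_group R C A) (hom_group R C B)"
    using compose_mod_hom[OF assms(1) _ assms(4)] assms(4)
    by (auto simp: hom_def hom_group_def compose_def mod_hom_closed mod_hom_add intro!: restrict_ext)
  then show ?thesis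
    using comm_group_hom_group[OF assms(1,2)] comm_group_hom_group[OF assms(1,3)]
    by (simp add: group_hom_def group_hom_axioms_def comm_group.axioms(2))
qed

section \<open>Short exact sequences\<close>

text \<open>Exactness in terms of elements, the form in which the diagram chases below use
  it.\<close>

lemma mod_short_exactD:
  assumes "mod_short_exact R A B D i p"
  shows "i \<in> mod_hom R A B" "p \<in> mod_hom R B D" "inj_on i (carrier A)"
    and "\<And>y. y \<in> carrier A \<Longrightarrow> p (i y) = \<zero>\<^bsub>D\<^esub>"
    and "\<And>x. \<lbrakk>x \<in> carrier B; p x = \<zero>\<^bsub>D\<^esub>\<rbrakk> \<Longrightarrow> \<exists>y\<in>carrier A. x = i y"
    and "\<And>z. z \<in> carrier D \<Longrightarrow> \<exists>x\<in>carrier B. p x = z"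
  using assms by (auto simp: mod_short_exact_def mod_kernel_iff set_eq_iff image_iff) metis+

text \<open>On its image the injection \<open>i\<close> has an inverse, and \<open>h\<close>
  followed by it is the factor. Its linearity is checked after applying \<open>i\<close>, where it
  becomes the linearity of \<open>h\<close>.\<close>

lemma mod_hom_factor:
  assumes "left_module R A" "left_module R B" "left_module R C"
    and i: "i \<in> mod_hom R A B" "inj_on i (carrier A)"
    and h: "h \<in> mod_hom R C B" "h ` carrier C \<subseteq> i ` carrier A"
  obtains k where "k \<in> mod_hom R C A" "compose (carrier C) i k = h"
proof
  interpret A: left_module R A by fact
  interpret B: left_module R B by fact
  interpret C: left_module R C by fact
  let ?k = "\<lambda>c\<in>carrier C. inv_into (carrier A) i (h c)"
  have k: "?k c \<in> carrier A" "i (?k c) = h c" if "c \<in> carrier C" for c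
    using that h(2) by (auto simp: inv_into_into f_inv_into_f image_subset_iff)
  show "?k \<in> mod_hom R C A"
  proof (rule mod_homI)
    show "?k \<in> carrier C \<rightarrow>\<^sub>E carrier A"
      using k by (auto simp: PiE_iff)
    show "?k (x \<oplus>\<^bsub>C\<^esub> y) = ?k x \<oplus>\<^bsub>A\<^esub> ?k y" if "x \<in> carrier C" "y \<in> carrier C" for x y
      using that k by (intro inj_onD[OF i(2)])
        (simp_all del: restrict_apply add: mod_hom_add[OF h(1)] mod_hom_add[OF i(1)])
    show "?k (r \<odot>\<^bsub>C\<^esub> x) = r \<odot>\<^bsub>A\<^esub> ?k x" if "r \<in> carrier R" "x \<in> carrier C" for r x
      using that k by (intro inj_onD[OF i(2)])
        (simp_all del: restrict_apply add: mod_hom_smult[OF h(1)] mod_hom_smult[OF i(1)])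
  qed
  then show "compose (carrier C) i ?k = h"
    using k by (intro mod_hom_eqI[OF compose_mod_hom[OF assms(3) _ i(1)] h(1)])
      (auto simp: compose_eq)
qed

lemma image_eq_iff:
  assumes "\<And>x. x \<in> A \<Longrightarrow> f x \<in> B"
  shows "f ` A = B \<longleftrightarrow> (\<forall>y\<in>B. \<exists>x\<in>A. f x = y)"
proof
  assume "f ` A = B"
  then show "\<forall>y\<in>B. \<exists>x\<in>A. f x = y" by blast
next
  assume *: "\<forall>y\<in>B. \<exists>x\<in>A. f x = y"
  show "f ` A = B"
  proof (rule subset_antisym)
    show "f ` A \<subseteq> B" using assms by (rule image_subsetI)
    show "B \<subseteq> f ` A" using * by (auto simp only: image_iff subset_iff)
  qed
qed

text \<open>\<open>Hom(C,-)\<close> is left exact: injectivity on the left and exactness in the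
  middle always hold, so only surjectivity on the right remains. Purity thus becomes a lifting
  property along \<open>p\<close>.\<close>

lemma hom_short_exact_iff:
  assumes "left_module R A" "left_module R B" "left_module R D" "left_module R C"
    and ex: "mod_short_exact R A B D i p"
  shows "short_exact_sequence (hom_group R C D) (hom_group R C B) (hom_group R C A)
      (compose (carrier C) p) (compose (carrier C) i) \<longleftrightarrow>
    (\<forall>h\<in>mod_hom R C D. \<exists>k\<in>mod_hom R C B. compose (carrier C) p k = h)"
proof -
  note exD = mod_short_exactD[OF ex]
  interpret i: group_hom "hom_group R C A" "hom_group R C B" "compose (carrier C) i"
    using group_hom_compose assms exD(1) by blast
  interpret p: group_hom "hom_group R C B" "hom_group R C D" "compose (carrier C) p"
    using group_hom_compose assms exD(2) by blast
  have inj: "inj_on (compose (carrier C) i) (carrier (hom_group R C A))"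
  proof (rule inj_onI)
    fix f g
    assume f: "f \<in> carrier (hom_group R C A)" and g: "g \<in> carrier (hom_group R C A)"
      and eq: "compose (carrier C) i f = compose (carrier C) i g"
    show "f = g"
    proof (rule mod_hom_eqI)
      show "f \<in> mod_hom R C A" "g \<in> mod_hom R C A"
        using f g by (auto simp: hom_group_def)
      fix x assume x: "x \<in> carrier C"
      have "i (f x) = i (g x)"
        using fun_cong[OF eq, of x] x by (simp add: compose_eq)
      with x f g show "f x = g x"
        by (auto simp: hom_group_def mod_hom_closed intro: inj_onD[OF exD(3)])
    qed
  qed
  have "kernel (hom_group R C B) (hom_group R C D) (compose (carrier C) p) =
      compose (carrier C) i ` carrier (hom_group R C A)" (is "?K = ?I")
  proof
    show "?K \<subseteq> ?I"
    proof
      fix f assume "f \<in> ?K"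
      then have f: "f \<in> mod_hom R C B" and "compose (carrier C) p f = (\<lambda>x\<in>carrier C. \<zero>\<^bsub>D\<^esub>)"
        by (auto simp: kernel_def hom_group_def)
      then have "p (f x) = \<zero>\<^bsub>D\<^esub>" if "x \<in> carrier C" for x
        using that by (metis compose_eq restrict_apply')
      \<comment> \<open>The values of \<open>f\<close> lie in the kernel of \<open>p\<close>, which
        is the image of \<open>i\<close>, so \<open>f\<close> factors through
        \<open>i\<close>.\<close>
      then have "f ` carrier C \<subseteq> i ` carrier A"
        using exD(5) mod_hom_closed[OF f] by blast
      from mod_hom_factor[OF assms(1,2,4) exD(1,3) f this] show "f \<in> ?I"
        by (metis (no_types, lifting) hom_group_def image_eqI partial_object.select_convs(1))
    qed
    show "?I \<subseteq> ?K"
    proof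
      fix f assume "f \<in> ?I"
      then obtain g where g: "g \<in> mod_hom R C A" and f: "f = compose (carrier C) i g"
        by (auto simp: hom_group_def)
      have "compose (carrier C) p f = (\<lambda>x\<in>carrier C. \<zero>\<^bsub>D\<^esub>)"
        unfolding f using exD(4) mod_hom_closed[OF g] by (auto simp: compose_def intro!: restrict_ext)
      then show "f \<in> ?K"
        unfolding f kernel_def using i.hom_closed g by (auto simp: hom_group_def)
    qed
  qed
  then have "short_exact_sequence (hom_group R C D) (hom_group R C B) (hom_group R C A)
      (compose (carrier C) p) (compose (carrier C) i) \<longleftrightarrow>
    compose (carrier C) p ` carrier (hom_group R C B) = carrier (hom_group R C D)"
    using inj p.homh i.homh p.group_hom_axioms i.group_hom_axioms p.H.group_axioms
    by (simp add: short_exact_sequence_iff epi_def mon_def)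
  also have "\<dots> \<longleftrightarrow> (\<forall>h\<in>mod_hom R C D. \<exists>k\<in>mod_hom R C B. compose (carrier C) p k = h)"
    unfolding hom_group_def partial_object.select_convs
    by (rule image_eq_iff) (rule compose_mod_hom[OF assms(4) _ exD(2)])
  finally show ?thesis .
qed

section \<open>Pullbacks\<close>

text \<open>In a morphism of short exact sequences that is the identity on the left end,
  the right square is a pullback.\<close>

lemma mod_short_exact_pullback:
  assumes "left_module R A" "left_module R X" "left_module R M"
    and "left_module R P" "left_module R N" "left_module R C"
    and X: "mod_short_exact R A X M i p" and P: "mod_short_exact R A P N j q"
    and f: "f \<in> mod_hom R M N" and g: "g \<in> mod_hom R X P"
    and gi: "compose (carrier A) g i = j"
    and qg: "compose (carrier X) q g = compose (carrier X) f p"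
    and h: "h \<in> mod_hom R C M" and k: "k \<in> mod_hom R C P"
    and qk: "compose (carrier C) q k = compose (carrier C) f h"
  obtains l where "l \<in> mod_hom R C X" "compose (carrier C) p l = h"
proof
  interpret A: left_module R A by fact
  interpret X: left_module R X by fact
  interpret M: left_module R M by fact
  interpret P: left_module R P by fact
  interpret N: left_module R N by fact
  interpret C: left_module R C by fact
  note XD = mod_short_exactD[OF X] and PD = mod_short_exactD[OF P]
  note closed = mod_hom_closed[OF XD(1)] mod_hom_closed[OF XD(2)] mod_hom_closed[OF PD(1)]
    mod_hom_closed[OF PD(2)] mod_hom_closed[OF f] mod_hom_closed[OF g] mod_hom_closed[OF h]
    mod_hom_closed[OF k]
  have gi': "g (i y) = j y" if "y \<in> carrier A" for y
    using fun_cong[OF gi, of y] that by (simp add: compose_eq)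
  have qg': "q (g x) = f (p x)" if "x \<in> carrier X" for x
    using fun_cong[OF qg, of x] that by (simp add: compose_eq)
  have qk': "q (k c) = f (h c)" if "c \<in> carrier C" for c
    using fun_cong[OF qk, of c] that by (simp add: compose_eq)
  \<comment> \<open>Any preimage \<open>x\<close> of \<open>h c\<close> under \<open>p\<close>
    satisfies \<open>q (g x) = f (h c) = q (k c)\<close>, so \<open>k c\<close> and
    \<open>g x\<close> differ by some \<open>j y\<close>. Since \<open>g (i y) = j y\<close> and
    \<open>p\<close> kills \<open>i y\<close>, adding \<open>i y\<close> to \<open>x\<close> repairs
    the condition on \<open>g\<close> and keeps the one on \<open>p\<close>.\<close>
  have ex: "\<exists>x. x \<in> carrier X \<and> p x = h c \<and> g x = k c" if c: "c \<in> carrier C" for c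
  proof -
    obtain x where x: "x \<in> carrier X" "p x = h c"
      using XD(6) closed(7)[OF c] by blast
    have "q (k c \<ominus>\<^bsub>P\<^esub> g x) = \<zero>\<^bsub>N\<^esub>"
      using x c by (simp add: P.M.minus_eq closed mod_hom_add[OF PD(2)] qg' qk' N.M.r_neg
          mod_hom_minus[OF assms(4,5) PD(2)])
    then obtain y where y: "y \<in> carrier A" "k c \<ominus>\<^bsub>P\<^esub> g x = j y"
      using PD(5) x c closed by (meson P.M.minus_closed)
    have "g (x \<oplus>\<^bsub>X\<^esub> i y) = g x \<oplus>\<^bsub>P\<^esub> (k c \<ominus>\<^bsub>P\<^esub> g x)"
      using x y by (simp add: mod_hom_add[OF g] closed gi')
    also have "\<dots> = k c"
      using x c by (simp add: closed P.M.minus_eq P.M.add.m_lcomm[of "g x" "k c"] P.M.r_neg)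
    finally have "g (x \<oplus>\<^bsub>X\<^esub> i y) = k c" .
    moreover have "p (x \<oplus>\<^bsub>X\<^esub> i y) = h c"
      using x y c by (simp add: mod_hom_add[OF XD(2)] closed XD(4))
    ultimately show ?thesis
      using x y closed by blast
  qed
  \<comment> \<open>The maps \<open>p\<close> and \<open>g\<close> are jointly injective: two such
    elements differ by some \<open>i y\<close>, and \<open>j y = g (i y)\<close> vanishes, so
    \<open>y\<close> is zero by injectivity of \<open>j\<close>.\<close>
  have unique: "x = x'"
    if x: "x \<in> carrier X" "x' \<in> carrier X" and eq: "p x = p x'" "g x = g x'" for x x'
  proof -
    have "p (x \<ominus>\<^bsub>X\<^esub> x') = \<zero>\<^bsub>M\<^esub>"
      using x eq by (simp add: X.M.minus_eq closed mod_hom_add[OF XD(2)] M.M.r_neg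
          mod_hom_minus[OF assms(2,3) XD(2)])
    then obtain y where y: "y \<in> carrier A" "x \<ominus>\<^bsub>X\<^esub> x' = i y"
      using XD(5) x by (meson X.M.minus_closed)
    have "j y = g (x \<ominus>\<^bsub>X\<^esub> x')"
      using y gi' by simp
    also have "\<dots> = \<zero>\<^bsub>P\<^esub>"
      using x eq by (simp add: X.M.minus_eq closed mod_hom_add[OF g] P.M.r_neg
          mod_hom_minus[OF assms(2,4) g])
    also have "\<dots> = j \<zero>\<^bsub>A\<^esub>"
      using mod_hom_zero[OF assms(1,4) PD(1)] by simp
    finally have "y = \<zero>\<^bsub>A\<^esub>"
      using inj_onD[OF PD(3)] y by blast
    then have "x \<ominus>\<^bsub>X\<^esub> x' = \<zero>\<^bsub>X\<^esub>"
      using y mod_hom_zero[OF assms(1,2) XD(1)] by simp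
    then show ?thesis
      using x X.M.minus_equality[of x "\<ominus>\<^bsub>X\<^esub> x'"] by (simp add: X.M.minus_eq)
  qed
  \<comment> \<open>The chosen element is determined by \<open>h c\<close> and \<open>k c\<close>,
    so the choice is linear: by \<open>unique\<close>, sums and multiples are compared after
    applying \<open>p\<close> and \<open>g\<close>.\<close>
  let ?l = "\<lambda>c\<in>carrier C. SOME x. x \<in> carrier X \<and> p x = h c \<and> g x = k c"
  have l: "?l c \<in> carrier X" "p (?l c) = h c" "g (?l c) = k c" if "c \<in> carrier C" for c
    using someI_ex[OF ex[OF that]] that by simp_all
  show "?l \<in> mod_hom R C X"
  proof (rule mod_homI)
    show "?l \<in> carrier C \<rightarrow>\<^sub>E carrier X"
      using l(1) by (auto simp: PiE_iff)
    show "?l (x \<oplus>\<^bsub>C\<^esub> y) = ?l x \<oplus>\<^bsub>X\<^esub> ?l y" if "x \<in> carrier C" "y \<in> carrier C" for x y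
      using that l by (intro unique) (simp_all del: restrict_apply
          add: mod_hom_add[OF h] mod_hom_add[OF k] mod_hom_add[OF g] mod_hom_add[OF XD(2)])
    show "?l (r \<odot>\<^bsub>C\<^esub> x) = r \<odot>\<^bsub>X\<^esub> ?l x" if "r \<in> carrier R" "x \<in> carrier C" for r x
      using that l by (intro unique) (simp_all del: restrict_apply
          add: mod_hom_smult[OF h] mod_hom_smult[OF k] mod_hom_smult[OF g] mod_hom_smult[OF XD(2)])
  qed
  then show "compose (carrier C) p ?l = h"
    using l by (intro mod_hom_eqI[OF compose_mod_hom[OF assms(6) _ XD(2)] h])
      (auto simp: compose_eq)
qed

text \<open>The map \<open>e\<close> encodes pairs as elements: \<^const>\<open>cotorsion\<close> only speaks about extensions by modules
  with elements in the universe \<open>'u\<close>, not in \<open>'u \<times> 'u\<close>.\<close>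

definition pullback_mod ::
  "('a \<times> 'b \<Rightarrow> 'c) \<Rightarrow> ('r, 'a) module \<Rightarrow> ('r, 'b) module \<Rightarrow> ('a \<Rightarrow> 'n) \<Rightarrow> ('b \<Rightarrow> 'n) \<Rightarrow>
    ('r, 'c) module" where
  "pullback_mod e P Q q b =
     \<lparr>carrier = e ` {(x, y). x \<in> carrier P \<and> y \<in> carrier Q \<and> q x = b y},
      monoid.mult = (\<lambda>_ _. undefined), one = undefined,
      ring.zero = e (\<zero>\<^bsub>P\<^esub>, \<zero>\<^bsub>Q\<^esub>),
      ring.add = (\<lambda>u v. e (fst (inv_into UNIV e u) \<oplus>\<^bsub>P\<^esub> fst (inv_into UNIV e v), snd (inv_into UNIV e u) \<oplus>\<^bsub>Q\<^esub> snd (inv_into UNIV e v))),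
      smult = (\<lambda>r u. e (r \<odot>\<^bsub>P\<^esub> fst (inv_into UNIV e u), r \<odot>\<^bsub>Q\<^esub> snd (inv_into UNIV e u)))\<rparr>"

text \<open>Since \<open>e\<close> is injective, \<open>inv_into UNIV e\<close> decodes every code,
  and the operations become componentwise on codes.\<close>

lemma pullback_mod_simps:
  assumes "inj e"
  shows "u \<in> carrier (pullback_mod e P Q q b) \<longleftrightarrow>
      (\<exists>x\<in>carrier P. \<exists>y\<in>carrier Q. q x = b y \<and> u = e (x, y))"
    and "\<zero>\<^bsub>pullback_mod e P Q q b\<^esub> = e (\<zero>\<^bsub>P\<^esub>, \<zero>\<^bsub>Q\<^esub>)"
    and "e (x, y) \<oplus>\<^bsub>pullback_mod e P Q q b\<^esub> e (x', y') = e (x \<oplus>\<^bsub>P\<^esub> x', y \<oplus>\<^bsub>Q\<^esub> y')"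
    and "r \<odot>\<^bsub>pullback_mod e P Q q b\<^esub> e (x, y) = e (r \<odot>\<^bsub>P\<^esub> x, r \<odot>\<^bsub>Q\<^esub> y)"
  using assms by (auto simp: pullback_mod_def)

text \<open>Linearity of \<open>q\<close> and \<open>b\<close> makes the condition
  \<open>q x = b y\<close> stable under the operations; the module axioms hold in each
  component.\<close>

lemma left_module_pullback:
  assumes "left_module R P" "left_module R Q" "left_module R N" and e: "inj e"
    and q: "q \<in> mod_hom R P N" and b: "b \<in> mod_hom R Q N"
  shows "left_module R (pullback_mod e P Q q b)" (is "left_module R ?B")
proof (rule left_moduleI)
  interpret P: left_module R P by fact
  interpret Q: left_module R Q by fact
  interpret N: left_module R N by fact
  note simps = pullback_mod_simps[OF e] inj_eq[OF e] mod_hom_add[OF q] mod_hom_add[OF b]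
    mod_hom_smult[OF q] mod_hom_smult[OF b]
  show "ring R" by (rule P.R.ring_axioms)
  show "abelian_group ?B"
  proof (rule abelian_groupI)
    show "\<zero>\<^bsub>?B\<^esub> \<in> carrier ?B"
      using mod_hom_zero[OF assms(1,3) q] mod_hom_zero[OF assms(2,3) b] by (auto simp: simps)
    fix u assume "u \<in> carrier ?B"
    then obtain x y where "x \<in> carrier P" "y \<in> carrier Q" "q x = b y" "u = e (x, y)"
      by (auto simp: simps)
    then have "e (\<ominus>\<^bsub>P\<^esub> x, \<ominus>\<^bsub>Q\<^esub> y) \<in> carrier ?B" "e (\<ominus>\<^bsub>P\<^esub> x, \<ominus>\<^bsub>Q\<^esub> y) \<oplus>\<^bsub>?B\<^esub> u = \<zero>\<^bsub>?B\<^esub>"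
      using mod_hom_minus[OF assms(1,3) q] mod_hom_minus[OF assms(2,3) b]
      by (auto simp: simps P.M.l_neg Q.M.l_neg)
    then show "\<exists>v\<in>carrier ?B. v \<oplus>\<^bsub>?B\<^esub> u = \<zero>\<^bsub>?B\<^esub>" by blast
  qed (auto simp: simps P.M.add.m_ac Q.M.add.m_ac)
qed (auto simp: pullback_mod_simps[OF e] inj_eq[OF e] mod_hom_smult[OF q] mod_hom_smult[OF b]
    left_module.smult_closed[OF assms(1)] left_module.smult_closed[OF assms(2)]
    left_module.smult_l_distr[OF assms(1)] left_module.smult_l_distr[OF assms(2)]
    left_module.smult_r_distr[OF assms(1)] left_module.smult_r_distr[OF assms(2)]
    left_module.smult_assoc1[OF assms(1)] left_module.smult_assoc1[OF assms(2)]
    left_module.smult_one[OF assms(1)] left_module.smult_one[OF assms(2)])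

text \<open>The carrier is an image of a subset of \<open>carrier P \<times> carrier Q\<close>, and
  a product of two sets below an infinite cardinal stays below it. This makes the pullback a member
  of \<open>Mods R\<close>, hence an admissible middle term in \<open>Ext1\<close>.\<close>

lemma small_pullback:
  fixes P Q :: "('r, 'u) module" and e :: "'u \<times> 'u \<Rightarrow> 'u"
  assumes "infinite (UNIV :: 'u set)"
    and "small TYPE('u) (carrier P)" "small TYPE('u) (carrier Q)"
  shows "small TYPE('u) (carrier (pullback_mod e P Q q b))"
proof -
  have "|carrier (pullback_mod e P Q q b)| \<le>o |carrier P \<times> carrier Q|"
    by (rule surj_imp_ordLeq[of _ e]) (auto simp: pullback_mod_def)
  moreover have "|carrier P \<times> carrier Q| <o |UNIV :: 'u set|"
    using card_of_Times_ordLess_infinite assms by (auto simp: small_def)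
  ultimately show ?thesis
    unfolding small_def by (rule ordLeq_ordLess_trans)
qed

text \<open>The kernel of the projection to \<open>Q\<close> consists of the codes of pairs
  \<open>(x, 0)\<close> with \<open>q x = b 0 = 0\<close>, so \<open>x\<close> comes from
  \<open>K\<close>; surjectivity is inherited from \<open>q\<close>. Pulling back along
  \<open>b\<close> therefore keeps the left term \<open>K\<close>.\<close>

lemma pullback_short_exact:
  assumes "left_module R K" "left_module R P" "left_module R Q" "left_module R N" and e: "inj e"
    and ex: "mod_short_exact R K P N j q" and b: "b \<in> mod_hom R Q N"
  shows "mod_short_exact R K (pullback_mod e P Q q b) Q (\<lambda>y\<in>carrier K. e (j y, \<zero>\<^bsub>Q\<^esub>))
      (\<lambda>u\<in>carrier (pullback_mod e P Q q b). snd (inv_into UNIV e u))"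
    (is "mod_short_exact R K ?B Q ?i ?p")
proof -
  interpret K: left_module R K by fact
  interpret P: left_module R P by fact
  interpret Q: left_module R Q by fact
  interpret N: left_module R N by fact
  note exD = mod_short_exactD[OF ex]
  interpret B: left_module R ?B
    using left_module_pullback assms(2-4) e exD(2) b by blast
  have b0: "b \<zero>\<^bsub>Q\<^esub> = \<zero>\<^bsub>N\<^esub>"
    using mod_hom_zero assms(3,4) b by blast
  note simps = pullback_mod_simps[OF e] inj_eq[OF e] inv_f_f[OF e]
  have i_closed: "e (j y, \<zero>\<^bsub>Q\<^esub>) \<in> carrier ?B" if "y \<in> carrier K" for y
    using that exD(4) b0 mod_hom_closed[OF exD(1)] by (auto simp: simps)
  have p_e: "?p (e (x, y)) = y" if "x \<in> carrier P" "y \<in> carrier Q" "q x = b y" for x y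
    using that by (auto simp: simps)
  have i: "?i \<in> mod_hom R K ?B"
    using i_closed
    by (intro mod_homI) (auto simp: simps(2-) mod_hom_add[OF exD(1)] mod_hom_smult[OF exD(1)]
        Q.smult_r_zero)
  have p: "?p \<in> mod_hom R ?B Q"
  proof (rule mod_homI)
    show "?p \<in> carrier ?B \<rightarrow>\<^sub>E carrier Q"
      by (auto simp: simps)
    show "?p (u \<oplus>\<^bsub>?B\<^esub> v) = ?p u \<oplus>\<^bsub>Q\<^esub> ?p v" if uv: "u \<in> carrier ?B" "v \<in> carrier ?B" for u v
    proof -
      have "u \<oplus>\<^bsub>?B\<^esub> v \<in> carrier ?B" using uv by simp
      with uv show ?thesis by (auto simp: simps(2-)) (auto simp: simps)
    qed
    show "?p (r \<odot>\<^bsub>?B\<^esub> u) = r \<odot>\<^bsub>Q\<^esub> ?p u" if "r \<in> carrier R" "u \<in> carrier ?B" for r u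
    proof -
      have "r \<odot>\<^bsub>?B\<^esub> u \<in> carrier ?B" using that by simp
      with that show ?thesis by (auto simp: simps(2-)) (auto simp: simps)
    qed
  qed
  have "inj_on ?i (carrier K)"
    using exD(3) by (auto simp: inj_on_def simps)
  moreover have "?i ` carrier K = a_kernel ?B Q ?p"
  proof
    show "?i ` carrier K \<subseteq> a_kernel ?B Q ?p"
      using i_closed p_e[of _ "\<zero>\<^bsub>Q\<^esub>"] exD(4) b0 mod_hom_closed[OF exD(1)]
      by (auto simp: mod_kernel_iff simp del: restrict_apply)
    show "a_kernel ?B Q ?p \<subseteq> ?i ` carrier K"
    proof
      fix u assume u: "u \<in> a_kernel ?B Q ?p"
      then obtain x y where xy: "x \<in> carrier P" "y \<in> carrier Q" "q x = b y" "u = e (x, y)"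
        by (auto simp: mod_kernel_iff simps)
      have "y = \<zero>\<^bsub>Q\<^esub>"
        using u p_e[OF xy(1-3)] unfolding xy(4) by (simp add: mod_kernel_iff del: restrict_apply)
      moreover from this obtain z where "z \<in> carrier K" "x = j z"
        using exD(5)[OF xy(1)] xy(3) b0 by auto
      ultimately show "u \<in> ?i ` carrier K"
        using xy(4) by (auto simp: image_iff)
    qed
  qed
  moreover have "?p ` carrier ?B = carrier Q"
  proof
    show "?p ` carrier ?B \<subseteq> carrier Q"
      using mod_hom_closed[OF p] by blast
    show "carrier Q \<subseteq> ?p ` carrier ?B"
    proof
      fix y assume y: "y \<in> carrier Q"
      then obtain x where x: "x \<in> carrier P" "q x = b y"
        using exD(6) mod_hom_closed[OF b] by blast
      then have "e (x, y) \<in> carrier ?B" using y by (auto simp: simps)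
      with p_e[OF x(1) y x(2)] show "y \<in> ?p ` carrier ?B" by (metis imageI)
    qed
  qed
  ultimately show ?thesis
    using i p by (simp add: mod_short_exact_def)
qed

section \<open>Stable morphisms\<close>

lemma inaccessible_infinite: "inaccessible TYPE('u) \<Longrightarrow> infinite (UNIV :: 'u set)"
  using natLeq_ordLeq_cinfinite unfolding inaccessible_def
  by (metis card_of_Field_ordIso infinite_iff_natLeq_ordLeq ordLess_imp_ordLeq)

text \<open>\<open>Ext1 R F A\<close> has the class of split extensions as its only element. The
  class of \<open>(B, i, p)\<close> is an element of it, and \<open>(B, i, p)\<close> lies in its
  own class because the identity of \<open>B\<close> is a morphism of extensions.\<close>

lemma cotorsion_extension_splits:
  assumes "cotorsion R A" "flat R F" "(B, i, p) \<in> extensions R (Mods R) F A"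
  obtains s where "s \<in> mod_hom R F B" "compose (carrier F) p s = mod_id F"
proof -
  let ?E = "extensions R (Mods R) F A" and ?r = "yoneda_rel R (Mods R) F A"
  have "left_module R B" and exact: "mod_short_exact R A B F i p"
    using assms(3) by (auto simp: extensions_def Mods_def)
  note exD = mod_short_exactD[OF exact]
  have "compose (carrier A) (mod_id B) i = i" "compose (carrier B) p (mod_id B) = p"
    unfolding mod_id_def using exD(1,2)
    by (auto simp: mod_hom_def PiE_def intro!: Id_compose compose_Id)
  then have "((B, i, p), (B, i, p)) \<in> ?r"
    using assms(3) mod_id_hom[OF \<open>left_module R B\<close>] unfolding yoneda_rel_def by blast
  moreover have "?r `` {(B, i, p)} \<in> Ext1 R F A"
    unfolding Ext1_def using assms(3) by (rule quotientI)
  then have "?r `` {(B, i, p)} = Ext1_zero R F A"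
    using assms(1,2) by (simp add: cotorsion_def)
  ultimately have "(B, i, p) \<in> Ext1_zero R F A" by blast
  then show ?thesis
    using that by (auto simp: Ext1_zero_def)
qed

text \<open>Pull the sequence \<open>K \<rightarrow> P \<rightarrow> N\<close> back along
  \<open>b\<close>. The result is an extension of the flat \<open>Q\<close> by the cotorsion
  \<open>K\<close>, so it splits; a section followed by the projection to \<open>P\<close> lifts
  \<open>b\<close>.\<close>

lemma lift_from_flat:
  fixes Q K P N :: "('r, 'u) module"
  assumes inf: "infinite (UNIV :: 'u set)" and "left_module R N" "P \<in> Mods R"
    and K: "cotorsion R K" and Q: "flat R Q"
    and ex: "mod_short_exact R K P N j q" and b: "b \<in> mod_hom R Q N"
  obtains k where "k \<in> mod_hom R Q P" "compose (carrier Q) q k = b"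
proof -
  have "|UNIV :: ('u \<times> 'u) set| \<le>o |UNIV :: 'u set|"
    using card_of_Times_same_infinite[OF inf] by (simp add: ordIso_imp_ordLeq)
  \<comment> \<open>An infinite set is equinumerous with its square; this injection encodes the
    pairs of the pullback in \<open>'u\<close>.\<close>
  then obtain e :: "'u \<times> 'u \<Rightarrow> 'u" where e: "inj e"
    by (auto simp flip: card_of_ordLeq)
  have mods: "left_module R K" "left_module R P" "left_module R Q"
    "small TYPE('u) (carrier P)" "small TYPE('u) (carrier Q)"
    using assms by (auto simp: cotorsion_def flat_def Mods_def)
  note exD = mod_short_exactD[OF ex]
  define B where "B = pullback_mod e P Q q b"
  have B: "left_module R B"
    unfolding B_def using left_module_pullback mods assms(2) e exD(2) b by blast
  then interpret B: left_module R B .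
  interpret Q: left_module R Q by fact
  have "B \<in> Mods R"
    using B small_pullback[OF inf mods(4,5)] by (auto simp: Mods_def B_def)
  then obtain s where s: "s \<in> mod_hom R Q B"
    and ps: "compose (carrier Q) (\<lambda>u\<in>carrier B. snd (inv_into UNIV e u)) s = mod_id Q"
    using pullback_short_exact[OF mods(1-3) assms(2) e ex b, folded B_def]
    by (auto simp: extensions_def intro: cotorsion_extension_splits[OF K Q])
  note simps = pullback_mod_simps[OF e, where P = P and Q = Q and q = q and b = b, folded B_def] inv_f_f[OF e]
  \<comment> \<open>The other projection of the pullback, to the component in
    \<open>P\<close>.\<close>
  define g where "g = (\<lambda>u\<in>carrier B. fst (inv_into UNIV e u))"
  have g: "g \<in> mod_hom R B P"
  proof (rule mod_homI)
    show "g \<in> carrier B \<rightarrow>\<^sub>E carrier P"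
      by (auto simp: g_def simps)
    show "g (u \<oplus>\<^bsub>B\<^esub> v) = g u \<oplus>\<^bsub>P\<^esub> g v" if uv: "u \<in> carrier B" "v \<in> carrier B" for u v
    proof -
      have "u \<oplus>\<^bsub>B\<^esub> v \<in> carrier B" using uv by simp
      with uv show ?thesis by (simp add: g_def) (auto simp: simps)
    qed
    show "g (r \<odot>\<^bsub>B\<^esub> u) = r \<odot>\<^bsub>P\<^esub> g u" if "r \<in> carrier R" "u \<in> carrier B" for r u
    proof -
      have "r \<odot>\<^bsub>B\<^esub> u \<in> carrier B" using that by simp
      with that show ?thesis by (simp add: g_def) (auto simp: simps)
    qed
  qed
  have gs: "compose (carrier Q) g s \<in> mod_hom R Q P"
    using compose_mod_hom[OF mods(3) s g] .
  moreover have "compose (carrier Q) q (compose (carrier Q) g s) = b"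
  proof (rule mod_hom_eqI[OF compose_mod_hom[OF mods(3) gs exD(2)] b])
    fix y assume y: "y \<in> carrier Q"
    \<comment> \<open>\<open>s y\<close> is the code of a pair whose components have equal images in
      \<open>N\<close>. Its second component is \<open>y\<close> because \<open>s\<close> is a
      section; hence \<open>q\<close> sends its first component to \<open>b y\<close>.\<close>
    have "s y \<in> carrier B" using mod_hom_closed[OF s y] .
    moreover have "snd (inv_into UNIV e (s y)) = y"
      using fun_cong[OF ps, of y] y \<open>s y \<in> carrier B\<close> by (simp add: compose_eq mod_id_def)
    ultimately show "compose (carrier Q) q (compose (carrier Q) g s) y = b y"
      using y by (auto simp: compose_eq g_def simps)
  qed
  ultimately show ?thesis by (rule that)
qed

section \<open>Maps factoring through flat cotorsion modules\<close>

text \<open>A factorisation through some flat cotorsion \<open>Q\<close> can be moved to the fixed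
  \<open>P\<close>: the part \<open>Q \<rightarrow> N\<close> lifts along \<open>q\<close> because
  \<open>K\<close> is cotorsion. The varying \<open>Q\<close> disappears, and the stably zero maps
  become the image of one group homomorphism.\<close>

lemma flatcot_maps_eq_image:
  fixes N K P C :: "('r, 'u) module"
  assumes inf: "infinite (UNIV :: 'u set)" and sz: "syzygy R N K P j q" and C: "left_module R C"
  shows "flatcot_maps R C N = compose (carrier C) q ` mod_hom R C P"
proof
  have mods: "left_module R N" "P \<in> Mods R" "cotorsion R K" "P \<in> FlatCot R"
    and ex: "mod_short_exact R K P N j q"
    using sz by (auto simp: syzygy_def GFlatCot_def FlatCot_def GFlat_def Mods_def flat_def)
  show "compose (carrier C) q ` mod_hom R C P \<subseteq> flatcot_maps R C N"
    using mods(4) mod_short_exactD(2)[OF ex] by (auto simp: flatcot_maps_def)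
  show "flatcot_maps R C N \<subseteq> compose (carrier C) q ` mod_hom R C P"
  proof
    fix u assume "u \<in> flatcot_maps R C N"
    then obtain Q :: "('r, 'u) module" and a b where Q: "flat R Q"
      and a: "a \<in> mod_hom R C Q" and b: "b \<in> mod_hom R Q N"
      and u: "u = compose (carrier C) b a"
      by (auto simp: flatcot_maps_def FlatCot_def)
    obtain k where k: "k \<in> mod_hom R Q P" "compose (carrier Q) q k = b"
      using lift_from_flat[OF inf mods(1-3) Q ex b] .
    then have "u = compose (carrier C) q (compose (carrier C) k a)"
      unfolding u using compose_assoc[OF mod_hom_funcset[OF a]] by metis
    then show "u \<in> compose (carrier C) q ` mod_hom R C P"
      using compose_mod_hom[OF C a k(1)] by blast
  qed
qed

text \<open>Closure under addition is not visible from the definition, where two maps may factor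
  through different modules; as the image of composition with \<open>q\<close> the set is a
  subgroup.\<close>

lemma subgroup_flatcot_maps:
  fixes N K P C :: "('r, 'u) module"
  assumes "infinite (UNIV :: 'u set)" and sz: "syzygy R N K P j q" and C: "left_module R C"
  shows "subgroup (flatcot_maps R C N) (hom_group R C N)"
proof -
  have "left_module R P" "left_module R N" "q \<in> mod_hom R P N"
    using sz by (auto simp: syzygy_def GFlatCot_def FlatCot_def GFlat_def Mods_def flat_def
        mod_short_exact_def)
  then interpret group_hom "hom_group R C P" "hom_group R C N" "compose (carrier C) q"
    using C group_hom_compose by blast
  show ?thesis
    using img_is_subgroup flatcot_maps_eq_image[OF assms] by (simp add: hom_group_def)
qed

lemma flatcot_maps_subset: "left_module R M \<Longrightarrow> flatcot_maps R M N \<subseteq> mod_hom R M N"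
  by (auto simp: flatcot_maps_def intro: compose_mod_hom)

text \<open>The zero map factors through any flat cotorsion module. In \<open>lemma3p9\<close> no
  syzygy of \<open>M\<close> is at hand, so for maps into \<open>M\<close> this is applied with the
  module \<open>P\<close> from the syzygy of \<open>N\<close>.\<close>

lemma one_in_flatcot_maps:
  fixes C Q N :: "('r, 'u) module"
  assumes "left_module R C" "left_module R N" and Q: "Q \<in> FlatCot R"
  shows "\<one>\<^bsub>hom_group R C N\<^esub> \<in> flatcot_maps R C N"
proof -
  have mod_Q: "left_module R Q" using Q by (auto simp: FlatCot_def flat_def Mods_def)
  interpret CQ: comm_group "hom_group R C Q" using comm_group_hom_group assms(1) mod_Q .
  interpret QN: comm_group "hom_group R Q N" using comm_group_hom_group mod_Q assms(2) .
  have hom: "\<one>\<^bsub>hom_group R C Q\<^esub> \<in> mod_hom R C Q" "\<one>\<^bsub>hom_group R Q N\<^esub> \<in> mod_hom R Q N"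
    using CQ.one_closed QN.one_closed by (auto simp: hom_group_def)
  have "compose (carrier C) \<one>\<^bsub>hom_group R Q N\<^esub> \<one>\<^bsub>hom_group R C Q\<^esub> = \<one>\<^bsub>hom_group R C N\<^esub>"
    using mod_hom_closed[OF hom(1)] by (auto simp: hom_group_def compose_def intro!: restrict_ext)
  then show ?thesis
    using Q hom unfolding flatcot_maps_def by force
qed

text \<open>A factorisation through \<open>Q\<close> survives composition on either side, since the
  extra map is absorbed into one of the factors. These two ideal properties let composition descend
  to stable classes.\<close>

lemma flatcot_maps_compose:
  fixes A B C :: "('r, 'u) module"
  assumes "left_module R A" "left_module R B" "left_module R C"
  shows "\<lbrakk>u \<in> flatcot_maps R A B; g \<in> mod_hom R B C\<rbrakk> \<Longrightarrow> compose (carrier A) g u \<in> flatcot_maps R A C"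
    and "\<lbrakk>g \<in> mod_hom R A B; u \<in> flatcot_maps R B C\<rbrakk> \<Longrightarrow> compose (carrier A) u g \<in> flatcot_maps R A C"
proof -
  assume "u \<in> flatcot_maps R A B" and g: "g \<in> mod_hom R B C"
  then obtain Q :: "('r, 'u) module" and a b where Q: "Q \<in> FlatCot R" "a \<in> mod_hom R A Q" "b \<in> mod_hom R Q B"
    and u: "u = compose (carrier A) b a"
    by (auto simp: flatcot_maps_def)
  have "left_module R Q" using Q(1) by (auto simp: FlatCot_def flat_def Mods_def)
  then have "compose (carrier Q) g b \<in> mod_hom R Q C"
    using compose_mod_hom Q g by blast
  moreover have "compose (carrier A) g u = compose (carrier A) (compose (carrier Q) g b) a"
    unfolding u using compose_assoc[OF mod_hom_funcset[OF Q(2)]] .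
  ultimately show "compose (carrier A) g u \<in> flatcot_maps R A C"
    using Q unfolding flatcot_maps_def by blast
next
  assume g: "g \<in> mod_hom R A B" and "u \<in> flatcot_maps R B C"
  then obtain Q :: "('r, 'u) module" and a b where Q: "Q \<in> FlatCot R" "a \<in> mod_hom R B Q" "b \<in> mod_hom R Q C"
    and u: "u = compose (carrier B) b a"
    by (auto simp: flatcot_maps_def)
  have "compose (carrier A) u g = compose (carrier A) b (compose (carrier A) a g)"
    unfolding u using compose_assoc[OF mod_hom_funcset[OF g]] by metis
  then show "compose (carrier A) u g \<in> flatcot_maps R A C"
    using Q compose_mod_hom[OF assms(1) g Q(2)] unfolding flatcot_maps_def by blast
qed

section \<open>Composition of stable morphisms\<close>

text \<open>Multiplying by \<open>H\<close> fills up the coset: \<open>x\<close> alone yields all of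
  \<open>H #> x\<close>, and the rest of \<open>S\<close> adds nothing because \<open>H\<close> is
  closed under products. \<open>stable_comp\<close> has this shape, with \<open>S\<close> the set of
  composites of representatives.\<close>

lemma (in group) subgroup_set_mult_subset_coset:
  assumes H: "subgroup H G" and x: "x \<in> S" "x \<in> carrier G" and S: "S \<subseteq> H #> x"
  shows "H <#> S = H #> x"
proof
  show "H #> x \<subseteq> H <#> S"
    using x by (auto simp: r_coset_def set_mult_def)
  show "H <#> S \<subseteq> H #> x"
  proof
    fix z assume "z \<in> H <#> S"
    then obtain a s where a: "a \<in> H" and "s \<in> S" and z: "z = a \<otimes> s"
      by (auto simp: set_mult_def)
    then obtain c where c: "c \<in> H" "s = c \<otimes> x"
      using S by (auto simp: r_coset_def)
    have "z = (a \<otimes> c) \<otimes> x"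
      unfolding z c(2) using a c x subgroup.mem_carrier[OF H] by (simp add: m_assoc)
    then show "z \<in> H #> x"
      using subgroup.m_closed[OF H a c(1)] by (auto simp: r_coset_def)
  qed
qed

text \<open>In the expansion \<open>(v + f)(u + h) = v(u + h) + fu + fh\<close> the first two
  summands factor through flat cotorsion modules. So all composites of representatives lie in the
  coset of \<open>fh\<close>, and stable composition can be computed on representatives.\<close>

lemma stable_comp_coset:
  assumes "left_module R L" "left_module R M" "left_module R N"
    and LM: "\<one>\<^bsub>hom_group R L M\<^esub> \<in> flatcot_maps R L M"
    and MN: "subgroup (flatcot_maps R M N) (hom_group R M N)"
    and LN: "subgroup (flatcot_maps R L N) (hom_group R L N)"
    and h: "h \<in> mod_hom R L M" and f: "f \<in> mod_hom R M N"
  shows "stable_comp R L N (flatcot_maps R M N #>\<^bsub>hom_group R M N\<^esub> f)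
      (flatcot_maps R L M #>\<^bsub>hom_group R L M\<^esub> h) =
    flatcot_maps R L N #>\<^bsub>hom_group R L N\<^esub> compose (carrier L) f h"
proof -
  interpret L: left_module R L by fact
  interpret M: left_module R M by fact
  interpret N: left_module R N by fact
  interpret LM: comm_group "hom_group R L M" using comm_group_hom_group assms by blast
  interpret MN: comm_group "hom_group R M N" using comm_group_hom_group assms by blast
  interpret LN: comm_group "hom_group R L N" using comm_group_hom_group assms by blast
  let ?S = "{compose (carrier L) g k | g k. g \<in> flatcot_maps R M N #>\<^bsub>hom_group R M N\<^esub> f \<and>
    k \<in> flatcot_maps R L M #>\<^bsub>hom_group R L M\<^esub> h}"
  \<comment> \<open>Since the zero map belongs to \<open>flatcot_maps R L M\<close>, the map
    \<open>h\<close> lies in its own coset.\<close>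
  have "h \<in> flatcot_maps R L M #>\<^bsub>hom_group R L M\<^esub> h"
    using LM LM.l_one[of h] h unfolding r_coset_def
    by (metis (no_types, lifting) UN_iff hom_group_def partial_object.select_convs(1) singletonI)
  then have "compose (carrier L) f h \<in> ?S"
    using MN.rcos_self[OF _ MN, of f] f by (auto simp: hom_group_def)
  moreover have "compose (carrier L) f h \<in> carrier (hom_group R L N)"
    using compose_mod_hom assms f h by (auto simp: hom_group_def)
  moreover have "?S \<subseteq> flatcot_maps R L N #>\<^bsub>hom_group R L N\<^esub> compose (carrier L) f h"
  proof
    fix z assume "z \<in> ?S"
    then obtain v u where v: "v \<in> flatcot_maps R M N" and u: "u \<in> flatcot_maps R L M"
      and z: "z = compose (carrier L) (v \<otimes>\<^bsub>hom_group R M N\<^esub> f) (u \<otimes>\<^bsub>hom_group R L M\<^esub> h)"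
      by (auto simp: r_coset_def)
    have u': "u \<in> mod_hom R L M" and v': "v \<in> mod_hom R M N"
      using flatcot_maps_subset[OF assms(1)] u subgroup.mem_carrier[OF MN v]
      by (auto simp: hom_group_def)
    let ?k = "u \<otimes>\<^bsub>hom_group R L M\<^esub> h"
    have k: "?k \<in> mod_hom R L M"
      using LM.m_closed[of u h] u' h by (simp add: hom_group_def)
    have w: "compose (carrier L) v ?k \<otimes>\<^bsub>hom_group R L N\<^esub> compose (carrier L) f u
        \<in> flatcot_maps R L N"
      using flatcot_maps_compose[OF assms(1-3)] u v k f by (intro subgroup.m_closed[OF LN]) auto
    have "z = compose (carrier L) v ?k \<otimes>\<^bsub>hom_group R L N\<^esub> compose (carrier L) f u
        \<otimes>\<^bsub>hom_group R L N\<^esub> compose (carrier L) f h"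
      unfolding z using u' v' h f mod_hom_closed[OF k]
      by (auto simp: hom_group_def compose_def mod_hom_closed mod_hom_add N.M.add.m_ac
          intro!: restrict_ext)
    with w show "z \<in> flatcot_maps R L N #>\<^bsub>hom_group R L N\<^esub> compose (carrier L) f h"
      by (auto simp: r_coset_def)
  qed
  ultimately show ?thesis
    unfolding stable_comp_def by (intro LN.subgroup_set_mult_subset_coset[OF LN])
qed

section \<open>Phantom maps and purity relative to compact objects\<close>

theorem lemma3p9:
  fixes R :: "'r ring"
    and M N \<Omega>N P X :: "('r, 'u) module"
    and \<f> :: "('u \<Rightarrow> 'u) set"
    and i p j q :: "'u \<Rightarrow> 'u"
  assumes "inaccessible TYPE('u)"
    and "ring R" and "small TYPE('u) (carrier R)"
    and "right_coherent R"
    and "definable R (GFlat R :: ('r, 'u) module set)"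
    and "compactly_generated TYPE('u) R"
    and "M \<in> GFlatCot R" and "N \<in> GFlatCot R"
    and "\<f> \<in> carrier (stable_hom R M N)"
    and "syzygy R N \<Omega>N P j q"
    and "(X, i, p) \<in> eta R M \<Omega>N P j q \<f>"
  shows "phantom R M N \<f> \<longleftrightarrow> pure_relative R {C. compact_object R C} \<Omega>N X M i p"
proof -
  have inf: "infinite (UNIV :: 'u set)"
    using assms(1) by (rule inaccessible_infinite)
  have GFlatCot_mod: "left_module R A" if "A \<in> GFlatCot R" for A :: "('r, 'u) module"
    using that by (auto simp: GFlatCot_def GFlat_def Mods_def)
  \<comment> \<open>\<open>eta\<close> supplies a morphism of short exact sequences that is the
    identity on \<open>\<Omega>N\<close> and whose right-hand map \<open>f\<close> belongs to the
    given stable class.\<close>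
  obtain f g where f\<f>: "f \<in> \<f>" and g: "g \<in> mod_hom R X P"
    and gi: "compose (carrier \<Omega>N) g i = j" and qg: "compose (carrier X) q g = compose (carrier X) f p"
    and X: "X \<in> GFlatCot R" and exX: "mod_short_exact R \<Omega>N X M i p"
    using assms(11) by (auto simp: eta_def extensions_def)
  have exP: "mod_short_exact R \<Omega>N P N j q" and P: "P \<in> FlatCot R" and K: "\<Omega>N \<in> GFlatCot R"
    using assms(10) by (auto simp: syzygy_def)
  have mods: "left_module R \<Omega>N" "left_module R X" "left_module R M" "left_module R P" "left_module R N"
    using GFlatCot_mod assms(7,8) X K P by (auto simp: FlatCot_def flat_def Mods_def)
  note q = mod_short_exactD(2)[OF exP]
  note FN = subgroup_flatcot_maps[OF inf assms(10)]
  interpret MN: comm_group "hom_group R M N" using comm_group_hom_group mods by blast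
  \<comment> \<open>A stable morphism is the coset of some \<open>f'\<close>; as \<open>f\<close>
    lies in it, it is also the coset of \<open>f\<close>. So the map in the diagram may serve as
    representative.\<close>
  obtain f' where f': "f' \<in> carrier (hom_group R M N)"
      "\<f> = flatcot_maps R M N #>\<^bsub>hom_group R M N\<^esub> f'"
    using assms(9) by (auto simp: stable_hom_def carrier_FactGroup)
  then have \<f>: "\<f> = flatcot_maps R M N #>\<^bsub>hom_group R M N\<^esub> f"
    using MN.repr_independence[OF f\<f>[unfolded f'(2)] f'(1) FN[OF mods(3)]] by simp
  have "\<f> \<subseteq> carrier (hom_group R M N)"
    unfolding f'(2) using MN.r_coset_subset_G[OF subgroup.subset[OF FN[OF mods(3)]] f'(1)] .
  with f\<f> have f: "f \<in> mod_hom R M N"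
    by (auto simp: hom_group_def)
  \<comment> \<open>Both conditions quantify over the compact \<open>C\<close>, so they are compared
    for one \<open>C\<close> at a time.\<close>
  have "(\<forall>\<h>\<in>carrier (stable_hom R C M). stable_comp R C N \<f> \<h> = \<one>\<^bsub>stable_hom R C N\<^esub>) \<longleftrightarrow>
      short_exact_sequence (hom_group R C M) (hom_group R C X) (hom_group R C \<Omega>N)
        (compose (carrier C) p) (compose (carrier C) i)"
    if "compact_object R C" for C
  proof -
    have C: "left_module R C"
      using that GFlatCot_mod by (auto simp: compact_object_def)
    interpret CM: comm_group "hom_group R C M" using comm_group_hom_group mods C by blast
    interpret CN: comm_group "hom_group R C N" using comm_group_hom_group mods C by blast
    \<comment> \<open>The zero of the stable group is the coset \<open>flatcot_maps R C N\<close>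
      itself, and a coset equals the subgroup iff its representative lies in it.\<close>
    have zero_iff: "stable_comp R C N \<f> (flatcot_maps R C M #>\<^bsub>hom_group R C M\<^esub> h) =
        flatcot_maps R C N \<longleftrightarrow> compose (carrier C) f h \<in> flatcot_maps R C N"
      if h: "h \<in> mod_hom R C M" for h
      using stable_comp_coset[OF C mods(3,5) one_in_flatcot_maps[OF C mods(3) P] FN[OF mods(3)]
          FN[OF C] h f] compose_mod_hom[OF C h f] CN.coset_join1[OF _ _ FN[OF C]]
        CN.coset_join2[OF _ FN[OF C]] subgroup.subset[OF FN[OF C]]
      by (auto simp: \<f> hom_group_def)
    have lift_iff: "compose (carrier C) f h \<in> flatcot_maps R C N \<longleftrightarrow>
        (\<exists>k\<in>mod_hom R C X. compose (carrier C) p k = h)" if h: "h \<in> mod_hom R C M" for h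
    proof
      assume "compose (carrier C) f h \<in> flatcot_maps R C N"
      then obtain k where "k \<in> mod_hom R C P" "compose (carrier C) q k = compose (carrier C) f h"
        using flatcot_maps_eq_image[OF inf assms(10) C] by auto
      \<comment> \<open>The maps \<open>h\<close> and \<open>k\<close> agree in \<open>N\<close>, so
        they induce a map into the pullback \<open>X\<close>.\<close>
      then show "\<exists>k\<in>mod_hom R C X. compose (carrier C) p k = h"
        using mod_short_exact_pullback[OF mods C exX exP f g gi qg h] by blast
    next
      assume "\<exists>k\<in>mod_hom R C X. compose (carrier C) p k = h"
      then obtain k where k: "k \<in> mod_hom R C X" "h = compose (carrier C) p k" by blast
      \<comment> \<open>Here \<open>f p k = q g k\<close>, which factors through the flat cotorsion
        module \<open>P\<close>.\<close>
      have "compose (carrier C) f h = compose (carrier C) (compose (carrier X) q g) k"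
        unfolding k(2) qg using compose_assoc[OF mod_hom_funcset[OF k(1)]] .
      also have "\<dots> = compose (carrier C) q (compose (carrier C) g k)"
        using compose_assoc[OF mod_hom_funcset[OF k(1)]] by metis
      finally show "compose (carrier C) f h \<in> flatcot_maps R C N"
        using P q compose_mod_hom[OF C k(1) g] unfolding flatcot_maps_def by blast
    qed
    show ?thesis
      \<comment> \<open>Every stable morphism from \<open>C\<close> to \<open>M\<close> is the coset
        of some \<open>h\<close>. Vanishing on all classes therefore means that every
        \<open>h\<close> lifts along \<open>p\<close>, and by \<open>hom_short_exact_iff\<close>
        this is exactness.\<close>
      using zero_iff lift_iff unfolding hom_short_exact_iff[OF mods(1-3) C exX]
      by (simp add: stable_hom_def carrier_FactGroup) (simp add: hom_group_def)
  qed
  then show ?thesis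
    by (auto simp: phantom_def pure_relative_def)
qed

end
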